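(* Let $G$ be a finite abelian group, let $\Lambda$ be a subgroup of $G\times\widehat{G}$, and let $\tau\in\mathbb{C}^{o(G)}$, $f\in(\mathbb{C}^{o(G)})^*$. Then for all $x\in\mathbb{C}^{o(G)}$, $$S_{f,\tau,\Lambda}x=\sum_{\lambda\in\Lambda}f(\pi(\lambda)^{-1}x)\,\pi(\lambda)\tau=\frac{o(\Lambda)}{o(G)}\sum_{\mu\in\Lambda^0}f(\pi(\mu)^{-1}\tau)\,\pi(\mu)x=\frac{o(\Lambda)}{o(G)}S_{f,x,\Lambda^0}\tau.$$
   Context: $G$ is a finite abelian group (written additively), $\widehat{G}$ is its group of characters, and $o(\cdot)$ denotes the order of a group. $\mathbb{C}^{o(G)}$ is the space of vectors $(x_g)_{g\in G}$ and $(\mathbb{C}^{o(G)})^*$ is the space of linear functionals on it. For $\lambda=(k,\xi)\in G\times\widehat{G}$ the time-frequency shift operator $\pi(\lambda):\mathbb{C}^{o(G)}\to\mathbb{C}^{o(G)}$ is $\pi(\lambda)(x_g)_{g\in G}=(\xi(g)x_{g-k})_{g\in G}$; it is invertible. For a subgroup $\Lambda\subseteq G\times\widehat{G}$, $f\in(\mathbb{C}^{o(G)})^*$ and $\tau\in\mathbb{C}^{o(G)}$, the Gabor-Schauder frame operator is $S_{f,\tau,\Lambda}:\mathbb{C}^{o(G)}\to\mathbb{C}^{o(G)}$, $S_{f,\tau,\Lambda}x=\sum_{\lambda\in\Lambda}f(\pi(\lambda)^{-1}x)\pi(\lambda)\tau$. The adjoint subgroup of $\Lambda$ is $\Lambda^0=\{\mu\in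 G\times\widehat{G}:\pi(\lambda)\pi(\mu)=\pi(\mu)\pi(\lambda)\ \forall\lambda\in\Lambda\}$, which is a subgroup of $G\times\widehat{G}$. *)

theory Defs
  imports "HOL-Analysis.Analysis" "HOL-Algebra.Group"
begin

(* Let inv denote the inverse of a function, not the group inverse of HOL-Algebra. *)
unbundle no m_inv_syntax

definition additive_group :: "'g::ab_group_add monoid" where
  "additive_group = \<lparr>carrier = UNIV, mult = (+), one = 0\<rparr>"

definition circle_group :: "complex monoid" where
  "circle_group = \<lparr>carrier = {z. cmod z = 1}, mult = (*), one = 1\<rparr>"

definition character_group :: "('g::ab_group_add \<Rightarrow> complex) monoid" where
  "character_group =
     \<lparr>carrier = hom additive_group circle_group,
      mult = (\<lambda>\<xi> \<eta> g. \<xi> g * \<eta> g), one = (\<lambda>_. 1)\<rparr>"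

definition tf_group :: "('g::ab_group_add \<times> ('g \<Rightarrow> complex)) monoid" where
  "tf_group = additive_group \<times>\<times> character_group"

(* (complex, 'g) vec is complex ^ 'g; the infix notation would impose the sort finite
   on 'g, which clashes with the sort {finite,ab_group_add} needed here. *)

definition tf_shift ::
  "'g::{finite,ab_group_add} \<times> ('g \<Rightarrow> complex) \<Rightarrow> (complex, 'g) vec \<Rightarrow> (complex, 'g) vec" where
  "tf_shift = (\<lambda>(k, \<xi>) x. \<chi> g. \<xi> g * x $ (g - k))"

(* The function inverse is a genuine two-sided inverse here: see bij_tf_shift. *)

definition gabor_schauder_op ::
  "((complex, 'g::{finite,ab_group_add}) vec \<Rightarrow> complex) \<Rightarrow> (complex, 'g) vec \<Rightarrow>
   ('g \<times> ('g \<Rightarrow> complex)) set \<Rightarrow> (complex, 'g) vec \<Rightarrow> (complex, 'g) vec" where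
  "gabor_schauder_op f \<tau> \<Lambda> x =
     (\<Sum>\<nu>\<in>\<Lambda>. f (inv (tf_shift \<nu>) x) *s tf_shift \<nu> \<tau>)"

definition adjoint_subgroup ::
  "('g::{finite,ab_group_add} \<times> ('g \<Rightarrow> complex)) set \<Rightarrow> ('g \<times> ('g \<Rightarrow> complex)) set" where
  "adjoint_subgroup \<Lambda> =
     {\<mu> \<in> carrier tf_group.
        \<forall>\<nu>\<in>\<Lambda>. tf_shift \<nu> \<circ> tf_shift \<mu> = tf_shift \<mu> \<circ> tf_shift \<nu>}"

lemma carrier_character_group:
  "carrier character_group =
     {\<xi>. (\<forall>g. cmod (\<xi> g) = 1) \<and> (\<forall>g h. \<xi> (g + h) = \<xi> g * \<xi> h)}"
  by (auto simp: character_group_def hom_def additive_group_def circle_group_def)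

lemma comm_group_additive_group: "comm_group additive_group"
proof (rule comm_groupI)
  fix x :: 'a
  show "\<exists>y\<in>carrier additive_group. y \<otimes>\<^bsub>additive_group\<^esub> x = \<one>\<^bsub>additive_group\<^esub>"
    by (rule bexI[of _ "- x"]) (auto simp: additive_group_def)
qed (auto simp: additive_group_def algebra_simps)

lemma comm_group_character_group: "comm_group character_group"
proof (rule comm_groupI)
  fix \<xi> :: "'a \<Rightarrow> complex"
  assume \<xi>: "\<xi> \<in> carrier character_group"
  show "\<exists>\<eta>\<in>carrier character_group.
          \<eta> \<otimes>\<^bsub>character_group\<^esub> \<xi> = \<one>\<^bsub>character_group\<^esub>"
  proof (rule bexI[of _ "\<lambda>g. inverse (\<xi> g)"])
    have "\<xi> g \<noteq> 0" for g
      using \<xi> by (auto simp: carrier_character_group dest!: spec[of _ g])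
    then show "(\<lambda>g. inverse (\<xi> g)) \<otimes>\<^bsub>character_group\<^esub> \<xi> = \<one>\<^bsub>character_group\<^esub>"
      by (auto simp: character_group_def)
    show "(\<lambda>g. inverse (\<xi> g)) \<in> carrier character_group"
      using \<xi> by (auto simp: carrier_character_group norm_inverse)
  qed
qed (unfold carrier_character_group,
     auto simp: character_group_def norm_mult algebra_simps)

lemma group_tf_group: "group tf_group"
  unfolding tf_group_def
  by (intro DirProd_group comm_group.axioms(2)
      comm_group_additive_group comm_group_character_group)

lemma character_nonzero: "\<xi> \<in> carrier character_group \<Longrightarrow> \<xi> g \<noteq> 0"
  by (auto simp: carrier_character_group dest!: spec[of _ g])

lemma bij_tf_shift:
  assumes "\<nu> \<in> carrier tf_group"
  shows "bij (tf_shift \<nu>)"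
proof -
  obtain k \<xi> where l: "\<nu> = (k, \<xi>)" by force
  with assms have \<xi>: "\<xi> \<in> carrier character_group"
    by (auto simp: tf_group_def DirProd_def)
  show ?thesis
    by (rule o_bij[of "\<lambda>x. \<chi> g. x $ (g + k) / \<xi> (g + k)"])
       (auto simp: l tf_shift_def fun_eq_iff vec_eq_iff character_nonzero[OF \<xi>])
qed

lemma finite_carrier_tf_group:
  "finite (carrier (tf_group :: ('g::{finite,ab_group_add} \<times> ('g \<Rightarrow> complex)) monoid))"
proof -
  let ?n = "CARD('g)"
  have root: "\<xi> g ^ ?n = 1"
    if \<xi>: "\<xi> \<in> carrier character_group" for \<xi> :: "'g \<Rightarrow> complex" and g
  proof -
    have "(\<Prod>h\<in>UNIV. \<xi> h) = (\<Prod>h\<in>UNIV. \<xi> (g + h))"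
      by (rule prod.reindex_bij_witness[of _ "\<lambda>h. g + h" "\<lambda>h. h - g"]) auto
    also have "\<dots> = \<xi> g ^ ?n * (\<Prod>h\<in>UNIV. \<xi> h)"
      using \<xi> by (simp add: carrier_character_group prod.distrib)
    finally show ?thesis
      using character_nonzero[OF \<xi>] by simp
  qed
  have "carrier character_group \<subseteq> (UNIV :: 'g set) \<rightarrow>\<^sub>E {z::complex. z ^ ?n = 1}"
    using root by auto
  moreover have "finite ((UNIV :: 'g set) \<rightarrow>\<^sub>E {z::complex. z ^ ?n = 1})"
    by (intro finite_PiE finite finite_roots_unity) (simp add: Suc_le_eq)
  ultimately have "finite (carrier (character_group :: ('g \<Rightarrow> complex) monoid))"
    by (rule finite_subset)
  then show ?thesis
    by (simp add: tf_group_def DirProd_def additive_group_def)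
qed

end

theory Submission
  imports Defs
begin

text \<open>
  Expand everything in coordinates. If \<open>f v = (\<Sum>j. a\<^sub>j v\<^sub>j)\<close>, then in the \<open>g\<close>-th coordinate of
  either side the coefficient of \<open>a\<^sub>j x\<^sub>s \<tau>\<^sub>t\<close> vanishes unless \<open>s + t = g + j\<close>. In that case put
  \<open>k = s - j = g - t\<close> and \<open>l = g - s = t - j\<close>: the coefficient on the left is the sum of \<open>\<xi> l\<close> over
  all \<open>\<xi>\<close> with \<open>(k, \<xi>) \<in> \<Lambda>\<close>, and on the right it is \<open>o(\<Lambda>)/o(G)\<close> times the sum of \<open>\<eta> k\<close> over all
  \<open>\<eta>\<close> with \<open>(l, \<eta>) \<in> \<Lambda>\<^sup>0\<close> (lemma \<open>sum_tf_shift_nth\<close>). So the theorem amounts to the equality of these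
  two character sums, a Poisson summation formula for \<open>\<Lambda>\<close> (lemma \<open>poisson_summation_adjoint\<close>).

  Two shifts \<open>\<pi>(k, \<xi>)\<close> and \<open>\<pi>(l, \<eta>)\<close> commute iff \<open>\<xi> l = \<eta> k\<close>. Hence \<open>\<Lambda>\<^sup>0\<close> is the annihilator of
  \<open>\<Lambda>\<close> under the symplectic pairing \<open>\<xi> l / \<eta> k\<close>, and averaging this pairing over \<open>\<Lambda>\<close> gives the
  indicator function of \<open>\<Lambda>\<^sup>0\<close>. Substituting this average into the sum over \<open>\<Lambda>\<^sup>0\<close> and exchanging
  the sums leaves sums \<open>\<Sum>\<eta>. \<eta> (k - k')\<close> over the whole dual group, which are \<open>o(G)\<close> or \<open>0\<close>.

  This last orthogonality relation needs characters that separate the points of \<open>G\<close>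
  (lemma \<open>characters_separate_points\<close>). They are obtained as the eigenvalues of a common
  eigenfunction of all translations of \<open>G\<close>.
\<close>

section \<open>Characters separate points\<close>

definition nat_multiple :: "nat \<Rightarrow> 'g::ab_group_add \<Rightarrow> 'g" where
  "nat_multiple i k = (\<Sum>_<i. k)"

lemma nat_multiple_0 [simp]: "nat_multiple 0 k = 0"
  by (simp add: nat_multiple_def)

lemma nat_multiple_Suc: "nat_multiple (Suc i) k = k + nat_multiple i k"
  by (simp add: nat_multiple_def add.commute)

text \<open>Translating by \<open>k\<close> permutes the group, so it does not change the sum of all elements.\<close>
lemma nat_multiple_CARD: "nat_multiple CARD('g) k = (0 :: 'g::{finite,ab_group_add})"
proof -
  obtain e :: "nat \<Rightarrow> 'g" where e: "bij_betw e {..<CARD('g)} UNIV"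
    using ex_bij_betw_nat_finite[of "UNIV :: 'g set"] by (auto simp: atLeast0LessThan)
  have "nat_multiple CARD('g) k = (\<Sum>_\<in>(UNIV :: 'g set). k)"
    unfolding nat_multiple_def using sum.reindex_bij_betw[OF e, of "\<lambda>_. k"] by simp
  moreover have "(\<Sum>h\<in>(UNIV :: 'g set). h) = (\<Sum>h\<in>UNIV. k + h)"
    by (rule sum.reindex_bij_witness[of _ "\<lambda>h. k + h" "\<lambda>h. h - k"]) auto
  ultimately show ?thesis
    by (simp add: sum.distrib)
qed

text \<open>
  A primitive \<open>n\<close>-th root of unity \<open>\<omega>\<close> permutes the \<open>n\<close>-th roots of unity by multiplication,
  so the power sum equals \<open>\<omega>\<^sup>i\<close> times itself.
\<close>
lemma sum_power_roots_unity:
  assumes "0 < i" "i < n"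
  shows "(\<Sum>z | z ^ n = 1. z ^ i) = (0::complex)"
proof -
  define w where "w = cis (2 * pi / n)"
  have w_n: "w ^ n = 1"
    using assms by (simp add: w_def Complex.DeMoivre)
  have "inj_on (\<lambda>k. cis (2 * pi * real k / n)) {..<n}"
    using Complex.bij_betw_roots_unity[of n] assms by (simp add: bij_betw_def)
  then have "cis (2 * pi * real i / n) \<noteq> cis (2 * pi * real 0 / n)"
    using assms by (subst inj_on_eq_iff[of _ "{..<n}"]) auto
  then have w_i: "w ^ i \<noteq> 1"
    by (simp add: w_def Complex.DeMoivre mult_ac)
  have "w \<noteq> 0"
    by (simp add: w_def)
  then have "(\<Sum>z | z ^ n = 1. z ^ i) = (\<Sum>z | z ^ n = 1. (w * z) ^ i)"
    by (intro sum.reindex_bij_witness[of _ "\<lambda>z. w * z" "\<lambda>z. z / w"])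
       (auto simp: power_mult_distrib power_divide w_n)
  also have "\<dots> = w ^ i * (\<Sum>z | z ^ n = 1. z ^ i)"
    by (simp add: power_mult_distrib sum_distrib_left)
  finally show ?thesis
    using w_i by simp
qed

text \<open>
  If \<open>z\<close> is a root of unity of order dividing \<open>CARD('g)\<close>, this is \<open>CARD('g)\<close> times the projection
  of \<open>F\<close> to the functions that translation by \<open>k\<close> multiplies by \<open>1 / z\<close>.
\<close>
definition eigenpart :: "'g \<Rightarrow> complex \<Rightarrow> ('g::{finite,ab_group_add} \<Rightarrow> complex) \<Rightarrow> 'g \<Rightarrow> complex" where
  "eigenpart k z F g = (\<Sum>i<CARD('g). z ^ i * F (g + nat_multiple i k))"

lemma eigenpart_translate:
  fixes F :: "'g::{finite,ab_group_add} \<Rightarrow> complex"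
  assumes z: "z ^ CARD('g) = 1"
  shows "eigenpart k z F (g + k) = inverse z * eigenpart k z F g"
proof -
  have [simp]: "z \<noteq> 0"
    using z by (auto simp: power_0_left)
  define s where "s = (\<lambda>i. z ^ i * F (g + nat_multiple i k))"
  have "z * eigenpart k z F (g + k) = (\<Sum>i<CARD('g). s (Suc i))"
    by (simp add: eigenpart_def s_def nat_multiple_Suc sum_distrib_left mult_ac add_ac)
  also have "\<dots> = (\<Sum>i<CARD('g). s i) + s CARD('g) - s 0"
    using sum.lessThan_Suc[of s "CARD('g)"] sum.lessThan_Suc_shift[of s "CARD('g)"]
    by simp
  also have "s CARD('g) = s 0"
    by (simp add: s_def z nat_multiple_CARD)
  finally have "z * eigenpart k z F (g + k) = eigenpart k z F g"
    by (simp add: eigenpart_def s_def)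
  then show ?thesis
    by (simp add: field_simps)
qed

lemma eigenpart_preserves_eigenfunction:
  assumes "\<And>g. F (g + h) = c * F g"
  shows "eigenpart k z F (g + h) = c * eigenpart k z F g"
proof -
  have "F (g + h + nat_multiple i k) = c * F (g + nat_multiple i k)" for i
    using assms[of "g + nat_multiple i k"] by (simp add: add_ac)
  then show ?thesis
    by (simp add: eigenpart_def sum_distrib_left mult_ac)
qed

lemma sum_eigenpart:
  fixes F :: "'g::{finite,ab_group_add} \<Rightarrow> complex"
  shows "(\<Sum>z | z ^ CARD('g) = 1. eigenpart k z F g) = of_nat CARD('g) * F g"
proof -
  let ?N = "CARD('g)"
  have "(\<Sum>z | z ^ ?N = 1. eigenpart k z F g)
      = (\<Sum>i<?N. (\<Sum>z | z ^ ?N = 1. z ^ i) * F (g + nat_multiple i k))"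
    unfolding eigenpart_def by (subst sum.swap) (simp add: sum_distrib_right)
  also have "\<dots> = (\<Sum>i<?N. if i = 0 then of_nat ?N * F g else 0)"
    by (rule sum.cong) (auto simp: sum_power_roots_unity card_roots_unity_eq)
  finally show ?thesis
    by simp
qed

text \<open>
  The translations commute, so an eigenfunction for some of them stays one after projecting it
  to an eigenspace of a further translation, and one of these projections is nonzero because
  they sum up to a multiple of the function. The start is chosen so that the eigenvalue for \<open>h\<close>
  is not \<open>1\<close>: the indicator function of \<open>0\<close> is not invariant under translation by \<open>h\<close>, so it
  has a nonzero component for some other eigenvalue.
\<close>
lemma common_eigenfunction_of_translations:
  fixes h :: "'g::{finite,ab_group_add}"
  assumes "h \<noteq> 0"
  shows "\<exists>F :: 'g \<Rightarrow> complex. (\<exists>g. F g \<noteq> 0) \<and> (\<exists>c. c \<noteq> 1 \<and> (\<forall>g. F (g + h) = c * F g)) \<and>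
           (\<forall>k\<in>K. \<exists>c. c ^ CARD('g) = 1 \<and> (\<forall>g. F (g + k) = c * F g))"
  using finite[of K]
proof (induction K rule: finite_induct)
  case empty
  let ?D = "\<lambda>g::'g. of_bool (g = 0) :: complex"
  let ?R = "{z::complex. z ^ CARD('g) = 1}"
  have fin: "finite ?R"
    by (rule finite_roots_unity) (simp add: Suc_le_eq)
  have "\<exists>z\<in>?R - {1}. \<exists>g. eigenpart h z ?D g \<noteq> 0"
  proof (rule ccontr)
    assume "\<not> ?thesis"
    then have "(\<Sum>z\<in>?R. eigenpart h z ?D g) = eigenpart h 1 ?D g" for g
      using fin by (subst sum.remove[of _ 1]) auto
    then have D: "of_nat CARD('g) * ?D g = eigenpart h 1 ?D g" for g
      by (simp only: sum_eigenpart)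
    have "of_nat CARD('g) * ?D (0 + h) = of_nat CARD('g) * ?D 0"
      unfolding D by (subst eigenpart_translate) auto
    then show False
      using assms by simp
  qed
  then obtain z g where "z ^ CARD('g) = 1" "z \<noteq> 1" "eigenpart h z ?D g \<noteq> 0"
    by auto
  then show ?case
    by (intro exI[of _ "eigenpart h z ?D"] conjI exI[of _ g] exI[of _ "inverse z"])
       (auto simp: eigenpart_translate)
next
  case (insert k K)
  then obtain F :: "'g \<Rightarrow> complex" and g0 c where F: "F g0 \<noteq> 0" "c \<noteq> 1"
      "\<And>g. F (g + h) = c * F g"
      "\<forall>k\<in>K. \<exists>c. c ^ CARD('g) = 1 \<and> (\<forall>g. F (g + k) = c * F g)"
    by blast
  have "(\<Sum>z | z ^ CARD('g) = 1. eigenpart k z F g0) \<noteq> 0"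
    using F(1) by (simp add: sum_eigenpart)
  then obtain z where z: "z ^ CARD('g) = 1" "eigenpart k z F g0 \<noteq> 0"
    by (auto elim: sum.not_neutral_contains_not_neutral)
  have "\<exists>c. c ^ CARD('g) = 1 \<and> (\<forall>g. eigenpart k z F (g + k') = c * eigenpart k z F g)"
    if k': "k' \<in> insert k K" for k'
  proof (cases "k' = k")
    case True
    then show ?thesis
      using z(1)
      by (intro exI[of _ "inverse z"]) (auto simp: eigenpart_translate power_inverse)
  next
    case False
    then obtain d where "d ^ CARD('g) = 1" "\<And>g. F (g + k') = d * F g"
      using k' F(4) by blast
    then show ?thesis
      using eigenpart_preserves_eigenfunction[of F k' d k z] by blast
  qed
  then show ?case
    using z(2) F(2) eigenpart_preserves_eigenfunction[of F h c k z, OF F(3)] by blast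
qed

text \<open>
  The eigenvalues of a common eigenfunction depend multiplicatively on the translation and are
  roots of unity, so they form a character.
\<close>
theorem characters_separate_points:
  fixes h :: "'g::{finite,ab_group_add}"
  assumes "h \<noteq> 0"
  shows "\<exists>\<eta>\<in>carrier character_group. \<eta> h \<noteq> 1"
proof -
  obtain F :: "'g \<Rightarrow> complex" and g0 c where F: "F g0 \<noteq> 0" "c \<noteq> 1"
      "\<And>g. F (g + h) = c * F g"
      "\<forall>k. \<exists>c. c ^ CARD('g) = 1 \<and> (\<forall>g. F (g + k) = c * F g)"
    using common_eigenfunction_of_translations[OF assms, of UNIV] by blast
  then obtain \<eta> where \<eta>: "\<And>k. \<eta> k ^ CARD('g) = 1" "\<And>k g. F (g + k) = \<eta> k * F g"
    by metis
  have "\<eta> (k + l) * F g0 = \<eta> k * \<eta> l * F g0" for k l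
    using \<eta>(2)[of g0 "k + l"] \<eta>(2)[of "g0 + k" l] \<eta>(2)[of g0 k] by (simp add: add_ac mult_ac)
  then have "\<eta> (k + l) = \<eta> k * \<eta> l" for k l
    using F(1) by simp
  moreover have "cmod (\<eta> k) = 1" for k
    using power_eq_1_iff[OF \<eta>(1)[of k]] by simp
  moreover have "\<eta> h \<noteq> 1"
    using \<eta>(2)[of g0 h] F(1-3) by auto
  ultimately show ?thesis
    by (auto simp: carrier_character_group)
qed

section \<open>Orthogonality relations\<close>

text \<open>Multiplication by \<open>a\<close> permutes the group, so the sum equals \<open>\<phi> a\<close> times itself.\<close>
lemma (in group) sum_nontrivial_multiplicative_eq_0:
  fixes \<phi> :: "'a \<Rightarrow> 'c::field"
  assumes "a \<in> carrier G" "\<phi> a \<noteq> 1"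
    and mult: "\<And>b. b \<in> carrier G \<Longrightarrow> \<phi> (a \<otimes> b) = \<phi> a * \<phi> b"
  shows "(\<Sum>b\<in>carrier G. \<phi> b) = 0"
proof -
  have "(\<Sum>b\<in>carrier G. \<phi> b) = (\<Sum>b\<in>carrier G. \<phi> (a \<otimes> b))"
    using sum.reindex[OF inj_on_cmult[OF assms(1)], of \<phi>] surj_const_mult[OF assms(1)]
    by simp
  also have "\<dots> = \<phi> a * (\<Sum>b\<in>carrier G. \<phi> b)"
    by (simp add: mult sum_distrib_left)
  finally show ?thesis
    using assms(2) by simp
qed

lemma character_add: "\<xi> \<in> carrier character_group \<Longrightarrow> \<xi> (g + h) = \<xi> g * \<xi> h"
  by (simp add: carrier_character_group)

lemma character_0:
  assumes "\<xi> \<in> carrier character_group"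
  shows "\<xi> 0 = 1"
  using character_add[OF assms, of 0 0] character_nonzero[OF assms, of 0] by simp

lemma character_diff:
  assumes "\<xi> \<in> carrier character_group"
  shows "\<xi> (g - h) = \<xi> g / \<xi> h"
  using character_add[OF assms, of "g - h" h] character_nonzero[OF assms, of h]
  by (simp add: field_simps)

lemma finite_characters:
  "finite (carrier character_group :: ('g::{finite,ab_group_add} \<Rightarrow> complex) set)"
proof -
  have "carrier character_group \<subseteq> snd ` carrier (tf_group :: ('g \<times> ('g \<Rightarrow> complex)) monoid)"
    by (force simp: tf_group_def additive_group_def)
  then show ?thesis
    using finite_carrier_tf_group by (rule finite_surj[rotated])
qed

lemma sum_characters_nonzero:
  fixes h :: "'g::{finite,ab_group_add}"
  assumes "h \<noteq> 0"
  shows "(\<Sum>\<eta>\<in>carrier character_group. \<eta> h) = 0"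
proof -
  interpret group "character_group :: ('g \<Rightarrow> complex) monoid"
    by (rule comm_group.axioms(2)[OF comm_group_character_group])
  obtain \<eta> :: "'g \<Rightarrow> complex" where "\<eta> \<in> carrier character_group" "\<eta> h \<noteq> 1"
    using characters_separate_points[OF assms] by blast
  then show ?thesis
    by (rule sum_nontrivial_multiplicative_eq_0) (simp add: character_group_def)
qed

text \<open>
  Evaluate \<open>\<Sum>\<eta>. \<Sum>g. \<eta> g\<close> in both orders: only the trivial character contributes when \<open>g\<close> is summed
  first, and only \<open>g = 0\<close> contributes when \<open>\<eta>\<close> is summed first.
\<close>
lemma card_characters:
  "card (carrier character_group :: ('g::{finite,ab_group_add} \<Rightarrow> complex) set) = CARD('g)"
proof -
  let ?C = "carrier character_group :: ('g \<Rightarrow> complex) set"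
  interpret additive: group "additive_group :: 'g monoid"
    by (rule comm_group.axioms(2)[OF comm_group_additive_group])
  have one: "(\<lambda>_. 1) \<in> ?C"
    by (simp add: carrier_character_group)
  have nontrivial: "(\<Sum>g\<in>UNIV. \<eta> g) = 0" if \<eta>: "\<eta> \<in> ?C" "\<eta> \<noteq> (\<lambda>_. 1)" for \<eta>
  proof -
    obtain a where "\<eta> a \<noteq> 1"
      using \<eta>(2) by auto
    then show ?thesis
      using additive.sum_nontrivial_multiplicative_eq_0[of a \<eta>] character_add[OF \<eta>(1)]
      by (simp add: additive_group_def)
  qed
  have "(\<Sum>\<eta>\<in>?C. \<Sum>g\<in>UNIV. \<eta> g) = (\<Sum>\<eta>\<in>?C. if \<eta> = (\<lambda>_. 1) then of_nat CARD('g) else 0)"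
    by (rule sum.cong) (auto simp: nontrivial)
  also have "\<dots> = of_nat CARD('g)"
    using one by (simp add: finite_characters)
  finally have first: "(\<Sum>\<eta>\<in>?C. \<Sum>g\<in>UNIV. \<eta> g) = of_nat CARD('g)" .
  have "(\<Sum>\<eta>\<in>?C. \<Sum>g\<in>UNIV. \<eta> g) = (\<Sum>g\<in>UNIV. \<Sum>\<eta>\<in>?C. \<eta> g)"
    by (rule sum.swap)
  also have "\<dots> = (\<Sum>g\<in>(UNIV :: 'g set). if g = 0 then of_nat (card ?C) else 0)"
    by (rule sum.cong) (auto simp: sum_characters_nonzero character_0)
  finally have "of_nat (card ?C) = (of_nat CARD('g) :: complex)"
    using first by simp
  then show ?thesis
    by (simp only: of_nat_eq_iff)
qed

lemma sum_characters:
  fixes h :: "'g::{finite,ab_group_add}"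
  shows "(\<Sum>\<eta>\<in>carrier character_group. \<eta> h) = (if h = 0 then of_nat CARD('g) else 0)"
  by (simp add: sum_characters_nonzero character_0 card_characters)

section \<open>Poisson summation for a subgroup and its adjoint\<close>

lemma tf_group_carrier_iff: "(k, \<xi>) \<in> carrier tf_group \<longleftrightarrow> \<xi> \<in> carrier character_group"
  by (simp add: tf_group_def additive_group_def)

lemma tf_group_mult: "(k, \<xi>) \<otimes>\<^bsub>tf_group\<^esub> (l, \<eta>) = (k + l, \<lambda>g. \<xi> g * \<eta> g)"
  by (simp add: tf_group_def additive_group_def character_group_def DirProd_def)

lemma tf_shift_nth: "tf_shift (k, \<xi>) x $ g = \<xi> g * x $ (g - k)"
  by (simp add: tf_shift_def)

text \<open>
  The two products differ by the scalar \<open>\<xi> l / \<eta> k\<close>; evaluating at a unit vector shows that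
  this scalar must be \<open>1\<close> if they agree.
\<close>
lemma tf_shift_commute_iff:
  assumes \<xi>: "\<xi> \<in> carrier character_group" and \<eta>: "\<eta> \<in> carrier character_group"
  shows "tf_shift (k, \<xi>) \<circ> tf_shift (l, \<eta>) = tf_shift (l, \<eta>) \<circ> tf_shift (k, \<xi>) \<longleftrightarrow> \<xi> l = \<eta> k"
proof
  assume "tf_shift (k, \<xi>) \<circ> tf_shift (l, \<eta>) = tf_shift (l, \<eta>) \<circ> tf_shift (k, \<xi>)"
  from fun_cong[OF this, of "axis 0 1"]
  have "tf_shift (k, \<xi>) (tf_shift (l, \<eta>) (axis 0 1)) $ (k + l)
      = tf_shift (l, \<eta>) (tf_shift (k, \<xi>) (axis 0 1)) $ (k + l)"
    by simp
  then have "\<xi> (k + l) * \<eta> l = \<eta> (k + l) * \<xi> k"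
    by (simp add: tf_shift_nth axis_def)
  then show "\<xi> l = \<eta> k"
    by (simp add: character_add[OF \<xi>] character_add[OF \<eta>]
        character_nonzero[OF \<xi>] character_nonzero[OF \<eta>])
next
  assume eq: "\<xi> l = \<eta> k"
  show "tf_shift (k, \<xi>) \<circ> tf_shift (l, \<eta>) = tf_shift (l, \<eta>) \<circ> tf_shift (k, \<xi>)"
    by (simp add: fun_eq_iff vec_eq_iff tf_shift_nth character_diff[OF \<xi>]
        character_diff[OF \<eta>] eq algebra_simps)
qed

lemma adjoint_subgroup_iff:
  assumes "\<Lambda> \<subseteq> carrier tf_group"
  shows "(l, \<eta>) \<in> adjoint_subgroup \<Lambda> \<longleftrightarrow>
           \<eta> \<in> carrier character_group \<and> (\<forall>(k, \<xi>)\<in>\<Lambda>. \<xi> l = \<eta> k)"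
proof -
  have "\<xi> \<in> carrier character_group" if "(k, \<xi>) \<in> \<Lambda>" for k \<xi>
    using assms that tf_group_carrier_iff by blast
  then show ?thesis
    by (auto simp: adjoint_subgroup_def tf_group_carrier_iff tf_shift_commute_iff)
qed

text \<open>
  The summand is multiplicative in \<open>\<nu> \<in> \<Lambda>\<close>, and it is identically \<open>1\<close> exactly for \<open>(l, \<eta>)\<close> in the
  adjoint subgroup.
\<close>
lemma sum_symplectic_pairing:
  fixes \<Lambda> :: "('g::{finite,ab_group_add} \<times> ('g \<Rightarrow> complex)) set"
  assumes \<Lambda>: "subgroup \<Lambda> tf_group" and \<eta>: "\<eta> \<in> carrier character_group"
  shows "(\<Sum>\<nu>\<in>\<Lambda>. snd \<nu> l / \<eta> (fst \<nu>)) =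
           (if (l, \<eta>) \<in> adjoint_subgroup \<Lambda> then of_nat (card \<Lambda>) else 0)"
proof (cases "(l, \<eta>) \<in> adjoint_subgroup \<Lambda>")
  case True
  then have "(\<Sum>\<nu>\<in>\<Lambda>. snd \<nu> l / \<eta> (fst \<nu>)) = (\<Sum>\<nu>\<in>\<Lambda>. 1)"
    using character_nonzero[OF \<eta>]
    by (intro sum.cong) (auto simp: adjoint_subgroup_iff[OF subgroup.subset[OF \<Lambda>]])
  with True show ?thesis
    by simp
next
  case False
  interpret \<Lambda>: group "tf_group\<lparr>carrier := \<Lambda>\<rparr>"
    by (rule subgroup.subgroup_is_group[OF \<Lambda> group_tf_group])
  obtain k \<xi> where "(k, \<xi>) \<in> \<Lambda>" "\<xi> l \<noteq> \<eta> k"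
    using False \<eta> by (auto simp: adjoint_subgroup_iff[OF subgroup.subset[OF \<Lambda>]])
  then have "(\<Sum>\<nu>\<in>carrier (tf_group\<lparr>carrier := \<Lambda>\<rparr>). snd \<nu> l / \<eta> (fst \<nu>)) = 0"
    using character_nonzero[OF \<eta>]
    by (intro \<Lambda>.sum_nontrivial_multiplicative_eq_0[of "(k, \<xi>)"])
       (auto simp: tf_group_mult character_add[OF \<eta>])
  with False show ?thesis
    by simp
qed

text \<open>
  On the right, the indicator function of the adjoint subgroup is the average of the symplectic
  pairing over \<open>\<Lambda>\<close>. Summing over all characters \<open>\<eta>\<close> first then leaves only the elements of \<open>\<Lambda>\<close>
  with time shift \<open>k\<close>, by orthogonality.
\<close>
theorem poisson_summation_adjoint:
  fixes \<Lambda> :: "('g::{finite,ab_group_add} \<times> ('g \<Rightarrow> complex)) set"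
  assumes \<Lambda>: "subgroup \<Lambda> tf_group"
  shows "(\<Sum>\<nu> | \<nu> \<in> \<Lambda> \<and> fst \<nu> = k. snd \<nu> l) =
           of_nat (card \<Lambda>) / of_nat CARD('g) *
           (\<Sum>\<mu> | \<mu> \<in> adjoint_subgroup \<Lambda> \<and> fst \<mu> = l. snd \<mu> k)"
proof -
  let ?C = "carrier character_group :: ('g \<Rightarrow> complex) set"
  let ?A = "adjoint_subgroup \<Lambda>"
  have fin: "finite \<Lambda>"
    by (rule finite_subset[OF subgroup.subset[OF \<Lambda>] finite_carrier_tf_group])
  have "(\<Sum>\<mu> | \<mu> \<in> ?A \<and> fst \<mu> = l. snd \<mu> k) = (\<Sum>\<eta> | \<eta> \<in> ?C \<and> (l, \<eta>) \<in> ?A. \<eta> k)"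
    by (rule sum.reindex_bij_witness[of _ "Pair l" snd])
       (auto simp: adjoint_subgroup_iff[OF subgroup.subset[OF \<Lambda>]])
  also have "\<dots> = (\<Sum>\<eta>\<in>?C. if (l, \<eta>) \<in> ?A then \<eta> k else 0)"
    by (rule sum.inter_filter) (rule finite_characters)
  finally have "of_nat (card \<Lambda>) * (\<Sum>\<mu> | \<mu> \<in> ?A \<and> fst \<mu> = l. snd \<mu> k)
      = (\<Sum>\<eta>\<in>?C. \<eta> k * (if (l, \<eta>) \<in> ?A then of_nat (card \<Lambda>) else 0))"
    by (simp add: sum_distrib_left if_distrib cong: if_cong) (simp add: mult.commute cong: if_cong)
  also have "\<dots> = (\<Sum>\<eta>\<in>?C. \<Sum>\<nu>\<in>\<Lambda>. snd \<nu> l * \<eta> (k - fst \<nu>))"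
    by (rule sum.cong[OF refl], subst sum_symplectic_pairing[OF \<Lambda>, symmetric])
       (auto simp: sum_distrib_left character_diff mult_ac)
  also have "\<dots> = (\<Sum>\<nu>\<in>\<Lambda>. snd \<nu> l * (\<Sum>\<eta>\<in>?C. \<eta> (k - fst \<nu>)))"
    by (subst sum.swap) (simp add: sum_distrib_left)
  also have "\<dots> = (\<Sum>\<nu>\<in>\<Lambda>. if fst \<nu> = k then of_nat CARD('g) * snd \<nu> l else 0)"
    by (rule sum.cong) (auto simp: sum_characters)
  also have "\<dots> = of_nat CARD('g) * (\<Sum>\<nu> | \<nu> \<in> \<Lambda> \<and> fst \<nu> = k. snd \<nu> l)"
    by (simp add: sum.inter_filter[OF fin, symmetric] sum_distrib_left)
  finally show ?thesis
    by (simp add: field_simps)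
qed

section \<open>The frame operator in coordinates\<close>

lemma inv_tf_shift_nth:
  assumes "(k, \<xi>) \<in> carrier tf_group"
  shows "inv (tf_shift (k, \<xi>)) x $ j = x $ (j + k) / \<xi> (j + k)"
proof -
  have "inv (tf_shift (k, \<xi>)) x = (\<chi> g. x $ (g + k) / \<xi> (g + k))"
    using assms character_nonzero[of \<xi>]
    by (intro inv_f_eq bij_is_inj bij_tf_shift)
       (auto simp: vec_eq_iff tf_shift_nth tf_group_carrier_iff)
  then show ?thesis
    by simp
qed

lemma linear_functional_expansion:
  assumes "Vector_Spaces.linear (*s) (*) (f :: ('a::field, 'n::finite) vec \<Rightarrow> 'a)"
  shows "f v = (\<Sum>j\<in>UNIV. f (axis j 1) * v $ j)"
proof -
  interpret f: Vector_Spaces.linear "(*s)" "(*)" f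
    by (rule assms)
  have "f v = f (\<Sum>j\<in>UNIV. v $ j *s axis j 1)"
    by (simp add: basis_expansion)
  then show ?thesis
    by (simp add: f.sum f.scale mult.commute)
qed

text \<open>
  In the inner sum over \<open>k\<close>, the exchange of \<open>x\<close> and \<open>\<tau>\<close> amounts to the substitution of
  \<open>g - j - k\<close> for \<open>k\<close>, which swaps the time shift with the argument of the characters.
\<close>
lemma sum_tf_shift_nth:
  fixes \<Lambda> :: "('g::{finite,ab_group_add} \<times> ('g \<Rightarrow> complex)) set"
  assumes \<Lambda>: "\<Lambda> \<subseteq> carrier tf_group" and f: "Vector_Spaces.linear (*s) (*) f"
  shows "(\<Sum>\<nu>\<in>\<Lambda>. f (inv (tf_shift \<nu>) x) *s tf_shift \<nu> \<tau>) $ g =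
           (\<Sum>j\<in>UNIV. f (axis j 1) * (\<Sum>k\<in>UNIV. x $ (j + k) * \<tau> $ (g - k) *
              (\<Sum>\<nu> | \<nu> \<in> \<Lambda> \<and> fst \<nu> = k. snd \<nu> (g - j - k))))"
proof -
  have fin: "finite \<Lambda>"
    by (rule finite_subset[OF \<Lambda> finite_carrier_tf_group])
  let ?t = "\<lambda>j \<nu>. x $ (j + fst \<nu>) * \<tau> $ (g - fst \<nu>) * snd \<nu> (g - j - fst \<nu>)"
  have "(f (inv (tf_shift \<nu>) x) *s tf_shift \<nu> \<tau>) $ g = (\<Sum>j\<in>UNIV. f (axis j 1) * ?t j \<nu>)"
    if "\<nu> \<in> \<Lambda>" for \<nu>
  proof -
    obtain k \<xi> where \<nu>: "\<nu> = (k, \<xi>)"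
      by force
    then have mem: "(k, \<xi>) \<in> carrier tf_group"
      using that \<Lambda> by auto
    then have \<xi>: "\<xi> \<in> carrier character_group"
      by (simp add: tf_group_carrier_iff)
    show ?thesis
      unfolding \<nu>
      by (subst linear_functional_expansion[OF f])
         (simp add: inv_tf_shift_nth[OF mem] tf_shift_nth sum_distrib_left mult_ac
           character_diff[OF \<xi>] character_add[OF \<xi>])
  qed
  then have "(\<Sum>\<nu>\<in>\<Lambda>. f (inv (tf_shift \<nu>) x) *s tf_shift \<nu> \<tau>) $ g
      = (\<Sum>\<nu>\<in>\<Lambda>. \<Sum>j\<in>UNIV. f (axis j 1) * ?t j \<nu>)"
    by (simp del: vector_smult_component)
  also have "\<dots> = (\<Sum>j\<in>UNIV. f (axis j 1) * (\<Sum>\<nu>\<in>\<Lambda>. ?t j \<nu>))"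
    by (subst sum.swap) (simp add: sum_distrib_left)
  also have "\<dots> = (\<Sum>j\<in>UNIV. f (axis j 1) * (\<Sum>k\<in>UNIV. \<Sum>\<nu> | \<nu> \<in> \<Lambda> \<and> fst \<nu> = k. ?t j \<nu>))"
    by (simp only: sum.group[OF fin finite subset_UNIV])
  also have "\<dots> = (\<Sum>j\<in>UNIV. f (axis j 1) * (\<Sum>k\<in>UNIV. x $ (j + k) * \<tau> $ (g - k) *
              (\<Sum>\<nu> | \<nu> \<in> \<Lambda> \<and> fst \<nu> = k. snd \<nu> (g - j - k))))"
    by (simp add: sum_distrib_left)
  finally show ?thesis .
qed

section \<open>The duality formula\<close>

theorem theorem3p8:
  fixes \<Lambda> :: "('g::{finite,ab_group_add} \<times> ('g \<Rightarrow> complex)) set"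
    and \<tau> x :: "(complex, 'g) vec"
    and f :: "(complex, 'g) vec \<Rightarrow> complex"
  assumes "subgroup \<Lambda> tf_group"
    and "Vector_Spaces.linear (*s) (*) f"
  shows "gabor_schauder_op f \<tau> \<Lambda> x =
           (\<Sum>\<nu>\<in>\<Lambda>. f (inv (tf_shift \<nu>) x) *s tf_shift \<nu> \<tau>) \<and>
         (\<Sum>\<nu>\<in>\<Lambda>. f (inv (tf_shift \<nu>) x) *s tf_shift \<nu> \<tau>) =
           (of_nat (card \<Lambda>) / of_nat CARD('g)) *s
           (\<Sum>\<mu>\<in>adjoint_subgroup \<Lambda>. f (inv (tf_shift \<mu>) \<tau>) *s tf_shift \<mu> x) \<and>
         (of_nat (card \<Lambda>) / of_nat CARD('g)) *s
           (\<Sum>\<mu>\<in>adjoint_subgroup \<Lambda>. f (inv (tf_shift \<mu>) \<tau>) *s tf_shift \<mu> x) =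
         (of_nat (card \<Lambda>) / of_nat CARD('g)) *s
           gabor_schauder_op f x (adjoint_subgroup \<Lambda>) \<tau>"
proof -
  let ?c = "of_nat (card \<Lambda>) / of_nat CARD('g) :: complex"
  let ?A = "adjoint_subgroup \<Lambda>"
  have A: "?A \<subseteq> carrier tf_group"
    by (auto simp: adjoint_subgroup_def)
  have "(\<Sum>\<nu>\<in>\<Lambda>. f (inv (tf_shift \<nu>) x) *s tf_shift \<nu> \<tau>) $ g =
        (?c *s (\<Sum>\<mu>\<in>?A. f (inv (tf_shift \<mu>) \<tau>) *s tf_shift \<mu> x)) $ g" for g
  proof -
    have inner: "(\<Sum>k\<in>UNIV. x $ (j + k) * \<tau> $ (g - k) *
            (\<Sum>\<nu> | \<nu> \<in> \<Lambda> \<and> fst \<nu> = k. snd \<nu> (g - j - k)))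
        = ?c * (\<Sum>l\<in>UNIV. \<tau> $ (j + l) * x $ (g - l) *
            (\<Sum>\<mu> | \<mu> \<in> ?A \<and> fst \<mu> = l. snd \<mu> (g - j - l)))"
      (is "?L = ?c * (\<Sum>l\<in>UNIV. ?r l)")
      for j
    proof -
      have "?L = (\<Sum>l\<in>UNIV. ?c * ?r l)"
        unfolding poisson_summation_adjoint[OF assms(1)]
        by (rule sum.reindex_bij_witness[of _ "\<lambda>l. g - j - l" "\<lambda>k. g - j - k"])
           (simp_all add: mult_ac add.commute)
      then show ?thesis
        by (simp only: sum_distrib_left)
    qed
    show ?thesis
      unfolding vector_smult_component sum_tf_shift_nth[OF A assms(2)]
        sum_tf_shift_nth[OF subgroup.subset[OF assms(1)] assms(2)] inner
      by (simp add: sum_distrib_left mult_ac)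
  qed
  then show ?thesis
    by (simp only: gabor_schauder_op_def vec_eq_iff simp_thms)
qed

end
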